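(* There exists a finite simple planar graph \(G\) such that \(\chi_{\mathrm{so}}(G)=20\).
   Context: For a vertex \(v\) of a graph \(G\), \(N_G(v)\) denotes the open neighbourhood of \(v\). A proper coloring of \(G\) is a map \(\varphi:V(G)\to C\) to a set \(C\) of colors such that adjacent vertices receive distinct colors. A proper coloring \(\varphi\) is a strong odd coloring if, for every vertex \(v\in V(G)\) and every color \(\alpha\), the set \(N_G(v)\cap\varphi^{-1}(\alpha)\) has either size zero or odd size. The strong odd chromatic number \(\chi_{\mathrm{so}}(G)\) is the minimum number of colors in a strong odd coloring of \(G\). *)

theory Defs
  imports "HOL-Analysis.Analysis" "Graph_Theory.Pair_Digraph"
begin

text \<open>
  Finite simple graphs are the \<^locale>\<open>pair_graph\<close>s: finite, loop-free digraphs without parallel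
  arcs whose arc relation is symmetric. An undirected edge is thus a pair of opposite arcs.
\<close>

definition edges :: "'a pair_pre_digraph \<Rightarrow> 'a set set" where
  "edges G = {{u, v} | u v. (u, v) \<in> parcs G}"

definition neighbourhood :: "'a pair_pre_digraph \<Rightarrow> 'a \<Rightarrow> 'a set" where
  "neighbourhood G v = {u. (v, u) \<in> parcs G}"

text \<open>
  A drawing in the Euclidean plane: vertices are distinct points and each edge is an arc (an
  injective continuous image of the unit interval) joining its two ends. Since \<open>p\<close> is injective
  on vertices, the last two conditions say that an edge meets the vertex points only in its own
  ends, and that two different edges meet only in the points of their common ends.
\<close>

definition plane_drawing ::
  "'a pair_pre_digraph \<Rightarrow> ('a \<Rightarrow> real \<times> real) \<Rightarrow> ('a set \<Rightarrow> real \<Rightarrow> real \<times> real) \<Rightarrow> bool" where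
  "plane_drawing G p \<gamma> \<longleftrightarrow>
     inj_on p (pverts G) \<and>
     (\<forall>e \<in> edges G. arc (\<gamma> e) \<and> {pathstart (\<gamma> e), pathfinish (\<gamma> e)} = p ` e) \<and>
     (\<forall>e \<in> edges G. path_image (\<gamma> e) \<inter> p ` pverts G = p ` e) \<and>
     (\<forall>e \<in> edges G. \<forall>f \<in> edges G. e \<noteq> f \<longrightarrow>
        path_image (\<gamma> e) \<inter> path_image (\<gamma> f) = p ` (e \<inter> f))"

definition planar :: "'a pair_pre_digraph \<Rightarrow> bool" where
  "planar G \<longleftrightarrow> (\<exists>p \<gamma>. plane_drawing G p \<gamma>)"

definition proper_coloring :: "'a pair_pre_digraph \<Rightarrow> 'c set \<Rightarrow> ('a \<Rightarrow> 'c) \<Rightarrow> bool" where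
  "proper_coloring G C \<phi> \<longleftrightarrow>
     \<phi> ` pverts G \<subseteq> C \<and> (\<forall>(u, v) \<in> parcs G. \<phi> u \<noteq> \<phi> v)"

definition strong_odd_coloring :: "'a pair_pre_digraph \<Rightarrow> 'c set \<Rightarrow> ('a \<Rightarrow> 'c) \<Rightarrow> bool" where
  "strong_odd_coloring G C \<phi> \<longleftrightarrow>
     proper_coloring G C \<phi> \<and>
     (\<forall>v \<in> pverts G. \<forall>\<alpha> \<in> C.
        card (neighbourhood G v \<inter> \<phi> -` {\<alpha>}) = 0 \<or>
        odd (card (neighbourhood G v \<inter> \<phi> -` {\<alpha>})))"

definition strong_odd_chromatic_number :: "'a pair_pre_digraph \<Rightarrow> nat" where
  "strong_odd_chromatic_number G = (LEAST k. \<exists>\<phi>. strong_odd_coloring G {..<k} \<phi>)"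

text \<open>
  The minimum is attained: a coloring that gives all vertices different colors is strong odd.
\<close>

lemma strong_odd_coloring_card_pverts:
  assumes "pair_graph G"
  shows "\<exists>\<phi>. strong_odd_coloring G {..<card (pverts G)} \<phi>"
proof -
  interpret pair_graph G by fact
  obtain h where h: "bij_betw h (pverts G) {0..<card (pverts G)}"
    using ex_bij_betw_finite_nat pair_finite_verts by blast
  have inj: "h u \<noteq> h v" if "(u, v) \<in> parcs G" for u v
    using that h arc_fst_in_verts[OF that] arc_snd_in_verts[OF that] pair_no_loops[OF that]
    by (auto simp: bij_betw_def dest: inj_onD)
  have "card (neighbourhood G v \<inter> h -` {\<alpha>}) = 0 \<or> odd (card (neighbourhood G v \<inter> h -` {\<alpha>}))"
    for v \<alpha>
  proof (cases "neighbourhood G v \<inter> h -` {\<alpha>} = {}")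
    case False
    then obtain u where u: "u \<in> neighbourhood G v \<inter> h -` {\<alpha>}" by blast
    have "neighbourhood G v \<subseteq> pverts G"
      using arc_snd_in_verts by (force simp: neighbourhood_def)
    with u h have "neighbourhood G v \<inter> h -` {\<alpha>} = {u}"
      by (auto simp: bij_betw_def dest: inj_onD)
    then show ?thesis by simp
  qed simp
  then have "strong_odd_coloring G {..<card (pverts G)} h"
    using inj h
    by (auto simp: strong_odd_coloring_def proper_coloring_def bij_betw_def atLeast0LessThan)
  then show ?thesis by blast
qed

lemma strong_odd_coloring_chromatic_number:
  assumes "pair_graph G"
  shows "\<exists>\<phi>. strong_odd_coloring G {..<strong_odd_chromatic_number G} \<phi>"
  unfolding strong_odd_chromatic_number_def
  by (rule LeastI) (rule strong_odd_coloring_card_pverts[OF assms])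

end

theory Submission
  imports Defs
begin

text \<open>
  The graph has three hubs \<open>x, y, z\<close> and three paths of low-degree vertices: \<open>A\<close> on 6 vertices,
  all adjacent to \<open>x\<close> and \<open>y\<close>; \<open>B\<close> on 6 vertices, all adjacent to \<open>y\<close> and \<open>z\<close>; \<open>C\<close> on 5 vertices,
  all adjacent to \<open>x\<close> and \<open>z\<close>; and four further edges. Its 20 vertices must all get different
  colors. An inner path vertex sees only its two hubs and its two path neighbours, so a color
  used on none of the hubs cannot repeat within three consecutive vertices and meets each path at
  most twice. If it meets the paths in \<open>a, b, c\<close> vertices, the hubs force \<open>a + b\<close>, \<open>b + c\<close>, \<open>a + c\<close>
  to be \<open>0\<close> or odd; the sum of these is even, so one of them is \<open>0\<close>, and the color is used at most
  once. The edges \<open>xy\<close> and \<open>yz\<close>, and the edges joining the ends of \<open>C\<close> to ends of \<open>B\<close> and \<open>A\<close>,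
  rule out that a hub shares its color.
\<close>

section \<open>Straight-line drawings, tested by signs of determinants\<close>

definition orient :: "'a::comm_ring \<times> 'a \<Rightarrow> 'a \<times> 'a \<Rightarrow> 'a \<times> 'a \<Rightarrow> 'a" where
  "orient p q r = (fst q - fst p) * (snd r - snd p) - (snd q - snd p) * (fst r - fst p)"

lemma orient_affine:
  fixes p q r s :: "real \<times> real"
  shows "orient p q ((1 - t) *\<^sub>R r + t *\<^sub>R s) = (1 - t) * orient p q r + t * orient p q s"
  by (simp add: orient_def algebra_simps)

lemma orient_closed_segment:
  fixes p q :: "real \<times> real"
  assumes "z \<in> closed_segment p q"
  shows "orient p q z = 0"
proof -
  from assms obtain t where "z = (1 - t) *\<^sub>R p + t *\<^sub>R q"
    by (auto simp: in_segment)
  then show ?thesis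
    by (simp only: orient_affine) (simp add: orient_def)
qed

text \<open>The sign of \<open>orient p q\<close> tells the side of the line through
  \<open>p\<close> and \<open>q\<close>. It is affine in its last argument, so it keeps a strict
  sign between \<open>r\<close> and \<open>s\<close>, while it vanishes on the segment from
  \<open>p\<close> to \<open>q\<close>.\<close>

lemma closed_segment_disjoint_same_side:
  fixes p q r s :: "real \<times> real"
  assumes "orient p q r * orient p q s > 0"
  shows "closed_segment p q \<inter> closed_segment r s = {}"
proof (rule ccontr)
  assume "\<not> ?thesis"
  then obtain z where z: "z \<in> closed_segment p q" "z \<in> closed_segment r s" by blast
  then obtain t where t: "z = (1 - t) *\<^sub>R r + t *\<^sub>R s" "0 \<le> t" "t \<le> 1"
    by (auto simp: in_segment)
  let ?a = "orient p q r" and ?b = "orient p q s"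
  have "(1 - t) * ?a + t * ?b = 0"
    using orient_closed_segment[OF z(1)] by (simp only: t(1) orient_affine)
  \<comment> \<open>Multiplying by \<open>?a\<close> makes both summands nonnegative, whichever side
    \<open>r\<close> and \<open>s\<close> are on.\<close>
  then have "?a * ((1 - t) * ?a + t * ?b) = 0" by simp
  then have "(1 - t) * (?a * ?a) + t * (?a * ?b) = 0" by (simp add: algebra_simps)
  moreover have "?a * ?a > 0" using assms by (auto simp: zero_less_mult_iff)
  ultimately have "(1 - t) * (?a * ?a) = 0 \<and> t * (?a * ?b) = 0"
    using assms t(2,3) by (subst (asm) add_nonneg_eq_0_iff) auto
  then show False
    using assms by auto
qed

lemma closed_segment_Int_common_end:
  fixes c r w :: "real \<times> real"
  assumes "orient c r w \<noteq> 0"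
  shows "closed_segment c r \<inter> closed_segment c w = {c}"
proof -
  have "z = c" if z: "z \<in> closed_segment c r" "z \<in> closed_segment c w" for z
  proof -
    obtain t where t: "z = (1 - t) *\<^sub>R c + t *\<^sub>R w"
      using z(2) by (auto simp: in_segment)
    have "t * orient c r w = 0"
      using orient_closed_segment[OF z(1)] by (simp only: t orient_affine) (simp add: orient_def)
    then show ?thesis using assms t by simp
  qed
  then show ?thesis by auto
qed

text \<open>Coordinates stay integral so that the determinant tests can be evaluated;
  \<open>orient\<close> is polymorphic so that the values carry over to the real plane.\<close>

definition real_point :: "int \<times> int \<Rightarrow> real \<times> real" where
  "real_point p = (of_int (fst p), of_int (snd p))"

lemma orient_real_point: "orient (real_point p) (real_point q) (real_point r) = of_int (orient p q r)"
  by (simp add: orient_def real_point_def)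

lemma inj_real_point: "inj real_point"
  by (auto simp: inj_def real_point_def prod_eq_iff)

text \<open>A sufficient, executable test. Edges with a common end must not be collinear; for
  disjoint edges, the line through one of them must leave the other strictly on one side.\<close>

fun compatible :: "(nat \<Rightarrow> int \<times> int) \<Rightarrow> nat \<times> nat \<Rightarrow> nat \<times> nat \<Rightarrow> bool" where
  "compatible P (u, v) (s, t) =
    (if u = s then orient (P u) (P v) (P t) \<noteq> 0
     else if v = t then orient (P v) (P u) (P s) \<noteq> 0
     else if u = t then orient (P u) (P v) (P s) \<noteq> 0
     else if v = s then orient (P v) (P u) (P t) \<noteq> 0
     else orient (P u) (P v) (P s) * orient (P u) (P v) (P t) > 0 \<or>
       orient (P s) (P t) (P u) * orient (P s) (P t) (P v) > 0)"

lemma compatible_segments: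
  assumes "compatible P (u, v) (s, t)" "u \<noteq> v" "s \<noteq> t"
  defines "p \<equiv> \<lambda>i. real_point (P i)"
  shows "closed_segment (p u) (p v) \<inter> closed_segment (p s) (p t) = p ` ({u, v} \<inter> {s, t})"
proof -
  have degenerate: "orient a b b = 0" for a b :: "int \<times> int"
    by (simp add: orient_def algebra_simps)
  have common: "closed_segment (p a) (p b) \<inter> closed_segment (p a) (p c) = p ` ({a, b} \<inter> {a, c})"
    if "orient (P a) (P b) (P c) \<noteq> 0" "a \<noteq> b" "a \<noteq> c" for a b c
  proof -
    have "b \<noteq> c" using that(1) degenerate by metis
    then have "{a, b} \<inter> {a, c} = {a}" using that by auto
    moreover
    have "orient (p a) (p b) (p c) \<noteq> 0"
      using that(1) by (simp add: p_def orient_real_point)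
    then have "closed_segment (p a) (p b) \<inter> closed_segment (p a) (p c) = {p a}"
      by (rule closed_segment_Int_common_end)
    ultimately show ?thesis by (simp only: image_insert image_empty)
  qed
  have apart: "closed_segment (p a) (p b) \<inter> closed_segment (p c) (p d) = {}"
    if "orient (P a) (P b) (P c) * orient (P a) (P b) (P d) > 0" for a b c d
    using that
    by (intro closed_segment_disjoint_same_side)
      (simp add: p_def orient_real_point flip: of_int_mult)
  consider "u = s" | "u \<noteq> s" "v = t" | "v \<noteq> t" "u = t" | "u \<noteq> t" "v = s"
    | "u \<noteq> s" "v \<noteq> t" "u \<noteq> t" "v \<noteq> s" by blast
  then show ?thesis
  proof cases
    case 1
    then show ?thesis using assms common[of u v t] by simp
  next
    case 2
    then show ?thesis
      using assms common[of v u s] by (simp add: closed_segment_commute insert_commute)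
  next
    case 3
    then have "u \<noteq> s" using assms(3) by simp
    with 3 show ?thesis
      using assms common[of u v s] by (simp add: closed_segment_commute insert_commute)
  next
    case 4
    then have "v \<noteq> t" using assms(3) by simp
    with 4 show ?thesis
      using assms common[of v u t] by (simp add: closed_segment_commute insert_commute)
  next
    case 5
    then show ?thesis using assms apart[of u v s t] apart[of s t u v] by auto
  qed
qed

section \<open>Graphs given by edge lists, and their planarity\<close>

definition edge_graph :: "nat \<Rightarrow> (nat \<times> nat) list \<Rightarrow> nat pair_pre_digraph" where
  "edge_graph n es = \<lparr>pverts = {..<n}, parcs = set es \<union> (set es)\<inverse>\<rparr>"

lemma pair_graph_edge_graph:
  assumes "\<forall>(u, v) \<in> set es. u < v \<and> v < n"
  shows "pair_graph (edge_graph n es)"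
proof
  show "finite (pverts (edge_graph n es))" "finite (parcs (edge_graph n es))"
    by (simp_all add: edge_graph_def)
  show "symmetric (with_proj (edge_graph n es))"
    by (auto simp: symmetric_def edge_graph_def sym_def arcs_ends_def arc_to_ends_def)
qed (use assms in \<open>fastforce simp: edge_graph_def\<close>)+

text \<open>Only pairs of edges need testing: by \<open>cover\<close> every vertex is an end of some
  edge, so a vertex on a foreign edge would be a point shared by two edges, hence a common end of
  both.\<close>

lemma planar_edge_graph:
  assumes bounds: "\<forall>(u, v) \<in> set es. u < v \<and> v < n"
    and cover: "\<forall>w < n. \<exists>(u, v) \<in> set es. w = u \<or> w = v"
    and inj: "inj_on P {..<n}"
    and compatible: "\<forall>e \<in> set es. \<forall>f \<in> set es. e \<noteq> f \<longrightarrow> compatible P e f"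
  shows "planar (edge_graph n es)"
proof -
  define p where "p = (\<lambda>i. real_point (P i))"
  \<comment> \<open>A drawing is indexed by unordered edges; \<open>Min\<close> and
    \<open>Max\<close> recover the listed order of the ends.\<close>
  define \<gamma> where "\<gamma> e = linepath (p (Min e)) (p (Max e))" for e
  have edges: "edges (edge_graph n es) = {{u, v} | u v. (u, v) \<in> set es}"
    by (auto simp: edges_def edge_graph_def)
  have p_inj: "inj_on p {..<n}"
    using inj by (auto simp: p_def inj_on_def inj_eq[OF inj_real_point])
  have \<gamma>: "\<gamma> {u, v} = linepath (p u) (p v)" if "(u, v) \<in> set es" for u v
  proof -
    have "u < v" using that bounds by auto
    then show ?thesis by (simp add: \<gamma>_def)
  qed
  have Int: "path_image (\<gamma> e) \<inter> path_image (\<gamma> f) = p ` (e \<inter> f)"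
    if "e \<in> edges (edge_graph n es)" "f \<in> edges (edge_graph n es)" "e \<noteq> f" for e f
  proof -
    from that obtain u v s t where e: "e = {u, v}" "(u, v) \<in> set es"
      and f: "f = {s, t}" "(s, t) \<in> set es" unfolding edges by blast
    have "(u, v) \<noteq> (s, t)" using that e f by auto
    then have "compatible P (u, v) (s, t)" using compatible e f by blast
    moreover have "u \<noteq> v" "s \<noteq> t" using bounds e f by auto
    ultimately show ?thesis
      using compatible_segments e f by (simp add: \<gamma> p_def)
  qed
  have "plane_drawing (edge_graph n es) p \<gamma>"
    unfolding plane_drawing_def
  proof (intro conjI ballI impI)
    show "inj_on p (pverts (edge_graph n es))" using p_inj by (simp add: edge_graph_def)
  next
    fix e assume "e \<in> edges (edge_graph n es)"
    then obtain u v where e: "e = {u, v}" "(u, v) \<in> set es" unfolding edges by blast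
    then have uv: "u < v" "v < n" using bounds by auto
    then have "p u \<noteq> p v" using inj_onD[OF p_inj, of u v] by auto
    then show "arc (\<gamma> e)" "{pathstart (\<gamma> e), pathfinish (\<gamma> e)} = p ` e"
      using e by (simp_all add: \<gamma>)
  next
    fix e assume e: "e \<in> edges (edge_graph n es)"
    then obtain u v where uv: "e = {u, v}" "(u, v) \<in> set es" unfolding edges by blast
    show "path_image (\<gamma> e) \<inter> p ` pverts (edge_graph n es) = p ` e"
    proof (intro equalityI subsetI)
      fix z assume z: "z \<in> path_image (\<gamma> e) \<inter> p ` pverts (edge_graph n es)"
      then obtain w where w: "z = p w" "w < n" by (auto simp: edge_graph_def)
      then obtain s t where st: "(s, t) \<in> set es" "w = s \<or> w = t" using cover by blast
      have "p w \<in> path_image (\<gamma> {s, t})" using st by (auto simp: \<gamma>)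
      then have "p w \<in> path_image (\<gamma> e) \<inter> path_image (\<gamma> {s, t})" using z w(1) by simp
      moreover have "{s, t} \<in> edges (edge_graph n es)" unfolding edges using st(1) by blast
      ultimately show "z \<in> p ` e"
        using Int[OF e, of "{s, t}"] st(2) w(1) by (cases "e = {s, t}") auto
    next
      fix z assume "z \<in> p ` e"
      then show "z \<in> path_image (\<gamma> e) \<inter> p ` pverts (edge_graph n es)"
        using uv bounds by (auto simp: \<gamma> edge_graph_def)
    qed
  qed (rule Int)
  then show ?thesis unfolding planar_def by blast
qed

section \<open>The graph and its planarity\<close>

definition fan_edges :: "nat \<Rightarrow> nat \<Rightarrow> nat list \<Rightarrow> (nat \<times> nat) list" where
  "fan_edges h k P = map (Pair h) P @ map (Pair k) P @ zip P (tl P)"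

text \<open>
  The hubs \<open>x, y, z\<close> are \<open>0, 1, 2\<close>; the paths \<open>A, B, C\<close> are \<open>3..8\<close>, \<open>9..14\<close>, \<open>15..19\<close>.
\<close>

definition hub_edges :: "(nat \<times> nat) list" where
  "hub_edges = [(0, 1), (1, 2), (9, 15), (8, 19)] @
    fan_edges 0 1 [3..<9] @ fan_edges 1 2 [9..<15] @ fan_edges 0 2 [15..<20]"

text \<open>
  A straight-line drawing, found by computer search. No two edges with a common end are collinear,
  so that \<open>compatible\<close> can test them by a non-zero determinant.
\<close>

definition hub_position :: "nat \<Rightarrow> int \<times> int" where
  "hub_position i = [(0, 0), (13, 1), (-2, 7),
    (4, 0), (4, -1), (6, -2), (4, -3), (1, -5), (1, -6),
    (2, 1), (2, 2), (3, 2), (4, 3), (3, 4), (4, 4),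
    (1, 2), (0, 1), (-1, 2), (-1, 1), (-3, 2)] ! i"

lemma hub_edges_eq:
  "hub_edges = [(0, 1), (1, 2), (9, 15), (8, 19),
    (0, 3), (0, 4), (0, 5), (0, 6), (0, 7), (0, 8),
    (1, 3), (1, 4), (1, 5), (1, 6), (1, 7), (1, 8),
    (3, 4), (4, 5), (5, 6), (6, 7), (7, 8),
    (1, 9), (1, 10), (1, 11), (1, 12), (1, 13), (1, 14),
    (2, 9), (2, 10), (2, 11), (2, 12), (2, 13), (2, 14),
    (9, 10), (10, 11), (11, 12), (12, 13), (13, 14),
    (0, 15), (0, 16), (0, 17), (0, 18), (0, 19),
    (2, 15), (2, 16), (2, 17), (2, 18), (2, 19),
    (15, 16), (16, 17), (17, 18), (18, 19)]"
  by (simp add: hub_edges_def fan_edges_def)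

lemma hub_edges_bounds: "\<forall>(u, v) \<in> set hub_edges. u < v \<and> v < 20"
  by (simp add: hub_edges_eq)

lemma upt_0_20: "[0..<20] = [0, 1, 2] @ [3..<9] @ [9..<15] @ [15..<20]"
  by code_simp

lemma planar_hub_graph: "planar (edge_graph 20 hub_edges)"
proof (rule planar_edge_graph)
  have "\<forall>w \<in> set [0..<20]. \<exists>(u, v) \<in> set hub_edges. w = u \<or> w = v"
    by (simp add: upt_0_20 hub_edges_eq)
  then show "\<forall>w < 20. \<exists>(u, v) \<in> set hub_edges. w = u \<or> w = v"
    by (simp only: atLeast_upt[symmetric]) blast
  have "distinct (map hub_position [0..<20])"
    by (simp add: upt_0_20 hub_position_def)
  then show "inj_on hub_position {..<20}"
    by (simp only: distinct_map atLeast_upt)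
  show "\<forall>e \<in> set hub_edges. \<forall>f \<in> set hub_edges. e \<noteq> f \<longrightarrow> compatible hub_position e f"
    unfolding hub_edges_eq by code_simp
qed (rule hub_edges_bounds)

section \<open>Color classes of strong odd colorings\<close>

definition adjacency :: "(nat \<times> nat) list \<Rightarrow> nat \<Rightarrow> nat list" where
  "adjacency es v = map snd (filter (\<lambda>e. fst e = v) es) @ map fst (filter (\<lambda>e. snd e = v) es)"

lemma set_adjacency: "u \<in> set (adjacency es v) \<longleftrightarrow> (u, v) \<in> set es \<or> (v, u) \<in> set es"
  by (force simp: adjacency_def)

lemma neighbourhood_edge_graph: "neighbourhood (edge_graph n es) v = set (adjacency es v)"
  by (auto simp: neighbourhood_def edge_graph_def set_adjacency)

text \<open>An edge listed in increasing order cannot recur reversed. Distinctness turns the number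
  of neighbours of one color into the length of a filtered list, which can be computed.\<close>

lemma distinct_adjacency:
  assumes "\<forall>(u, v) \<in> set es. u < v \<and> v < n" "distinct es"
  shows "distinct (adjacency es v)"
proof -
  have "(v, u) \<notin> set es" if "(u, v) \<in> set es" for u
    using bspec[OF assms(1), of "(u, v)"] bspec[OF assms(1), of "(v, u)"] that by auto
  then show ?thesis
    using assms(2) by (auto simp: adjacency_def distinct_map intro!: inj_onI prod_eqI)
qed

text \<open>Besides the hubs, only the middles of the path triples used below and the ends 8 and 9
  are needed. The middles appear as next vertex, two hubs, previous vertex.\<close>

lemma hub_adjacency:
  "adjacency hub_edges 0 = 1 # [3..<9] @ [15..<20]"
  "adjacency hub_edges 1 = 2 # [3..<9] @ [9..<15] @ [0]"
  "adjacency hub_edges 2 = [9..<15] @ [15..<20] @ [1]"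
  "adjacency hub_edges 4 = [5, 0, 1, 3]"
  "adjacency hub_edges 7 = [8, 0, 1, 6]"
  "adjacency hub_edges 8 = [19, 0, 1, 7]"
  "adjacency hub_edges 9 = [15, 10, 1, 2]"
  "adjacency hub_edges 10 = [11, 1, 2, 9]"
  "adjacency hub_edges 13 = [14, 1, 2, 12]"
  "adjacency hub_edges 16 = [17, 0, 2, 15]"
  "adjacency hub_edges 17 = [18, 0, 2, 16]"
  by (simp_all add: adjacency_def hub_edges_eq)

text \<open>\<open>Q\<close> is membership in one color class; independence and parity are all that
  the counting needs.\<close>

lemma hub_color_class:
  assumes indep: "\<forall>(u, v) \<in> set hub_edges. \<not> (Q u \<and> Q v)"
    and odd: "\<And>v. v < 20 \<Longrightarrow>
      length (filter Q (adjacency hub_edges v)) = 0 \<or> odd (length (filter Q (adjacency hub_edges v)))"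
  shows "length (filter Q [0..<20]) \<le> 1"
proof -
  have indep': "\<not> Q v" if "Q u" "(u, v) \<in> set hub_edges \<or> (v, u) \<in> set hub_edges" for u v
    using indep that by blast
  define a b c where "a = length (filter Q [3..<9])" and "b = length (filter Q [9..<15])"
    and "c = length (filter Q [15..<20])"
  \<comment> \<open>The path \<open>C\<close> is split twice: the last split gives
    \<open>c \<le> 2\<close>, the one before it gives \<open>c \<le> 1\<close> once 15 and 19 are
    excluded.\<close>
  have abc: "a = length (filter Q [3, 4, 5]) + length (filter Q [6, 7, 8])"
    "b = length (filter Q [9, 10, 11]) + length (filter Q [12, 13, 14])"
    "c = of_bool (Q 15) + length (filter Q [16, 17, 18]) + of_bool (Q 19)"
    "c = length (filter Q [15, 16, 17]) + length (filter Q [18, 19])"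
    by (simp_all add: a_def b_def c_def)
  \<comment> \<open>If both path neighbours \<open>u\<close> and \<open>w\<close> of
    \<open>v\<close> were in the class, the hubs \<open>h\<close> and \<open>k\<close>, being
    adjacent to \<open>u\<close>, would not be, and \<open>v\<close> would see exactly two
    members.\<close>
  have gap: "\<not> (Q u \<and> Q w)"
    if "adjacency hub_edges v = [w, h, k, u]" "v < 20" "(h, u) \<in> set hub_edges" "(k, u) \<in> set hub_edges"
    for u v w h k
  proof
    assume Q: "Q u \<and> Q w"
    then have "\<not> Q h" "\<not> Q k" using that(3,4) indep'[of u] by auto
    with Q show False using odd[OF that(2)] by (simp add: that(1))
  qed
  have third: "length (filter Q [u, v, w]) \<le> 1"
    if "adjacency hub_edges v = [w, h, k, u]" "v < 20" "(h, u) \<in> set hub_edges" "(k, u) \<in> set hub_edges"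
      "(u, v) \<in> set hub_edges" "(v, w) \<in> set hub_edges"
    for u v w h k
    using gap[OF that(1-4)] indep'[of u v] indep'[of v w] that(5,6) by auto
  have thirds: "length (filter Q [3, 4, 5]) \<le> 1" "length (filter Q [6, 7, 8]) \<le> 1"
    "length (filter Q [9, 10, 11]) \<le> 1" "length (filter Q [12, 13, 14]) \<le> 1"
    "length (filter Q [15, 16, 17]) \<le> 1" "length (filter Q [16, 17, 18]) \<le> 1"
    by (rule third, rule hub_adjacency; simp add: hub_edges_eq)+
  moreover have "length (filter Q [18, 19]) \<le> 1"
    using indep'[of 18 19] by (auto simp: hub_edges_eq)
  ultimately have le2: "a \<le> 2" "b \<le> 2" "c \<le> 2"
    unfolding abc(1,2,4) by linarith+
  \<comment> \<open>If \<open>Q 1\<close> holds, vertex 9 sees in the class only 1 and possibly 15,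
    and vertex 8 only 1 and possibly 19; parity forbids a second member.\<close>
  have ends: "\<not> (Q 1 \<and> Q 15)" "\<not> (Q 1 \<and> Q 19)"
  proof -
    have *: "\<not> Q 0 \<and> \<not> Q 2 \<and> \<not> Q 7 \<and> \<not> Q 10" if "Q 1"
      using indep'[OF that] by (simp add: hub_edges_eq)
    show "\<not> (Q 1 \<and> Q 15)" using odd[of 9] * by (auto simp: hub_adjacency)
    show "\<not> (Q 1 \<and> Q 19)" using odd[of 8] * by (auto simp: hub_adjacency)
  qed
  have hubs: "length (filter Q (adjacency hub_edges 0)) = of_bool (Q 1) + a + c"
    "length (filter Q (adjacency hub_edges 1)) = of_bool (Q 2) + a + b + of_bool (Q 0)"
    "length (filter Q (adjacency hub_edges 2)) = b + c + of_bool (Q 1)"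
    unfolding hub_adjacency a_def b_def c_def by (simp_all del: upt_rec_numeral)
  have isolated: "length (filter Q (adjacency hub_edges u)) = 0" if "Q u" for u
    using indep'[OF that] by (auto simp: filter_empty_conv set_adjacency)
  have hub0: "\<not> Q 1 \<and> a = 0 \<and> c = 0" if "Q 0"
    using isolated[OF that] hubs(1) by simp
  have hub1: "\<not> Q 0 \<and> \<not> Q 2 \<and> a = 0 \<and> b = 0 \<and> c \<le> 1" if "Q 1"
    using isolated[OF that] hubs(2) that ends thirds(6) abc(3) by simp
  have hub2: "\<not> Q 1 \<and> b = 0 \<and> c = 0" if "Q 2"
    using isolated[OF that] hubs(3) by simp
  have odd_or_0: "of_bool (Q 1) + a + c = 0 \<or> odd (of_bool (Q 1) + a + c)"
    "of_bool (Q 2) + a + b + of_bool (Q 0) = 0 \<or> odd (of_bool (Q 2) + a + b + of_bool (Q 0))"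
    "b + c + of_bool (Q 1) = 0 \<or> odd (b + c + of_bool (Q 1))"
    using odd[of 0] odd[of 1] odd[of 2] unfolding hubs by simp_all
  have "length (filter Q [0..<20]) = of_bool (Q 0) + of_bool (Q 1) + of_bool (Q 2) + a + b + c"
    unfolding upt_0_20 a_def b_def c_def by (simp del: upt_rec_numeral)
  \<comment> \<open>If \<open>Q 0\<close> and \<open>Q 2\<close> both held, hub 1 would see exactly
    two members. If exactly one hub is in the class, two path counts vanish and parity at the hubs
    makes the third, at most 2, vanish too. With no hub in the class, the parity of the pairwise
    sums leaves at most one path, met at most once.\<close>
  moreover have "of_bool (Q 0) + of_bool (Q 1) + of_bool (Q 2) + a + b + c \<le> 1"
  proof -
    have "a \<in> {0, 1, 2}" "b \<in> {0, 1, 2}" "c \<in> {0, 1, 2}"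
      using le2 by auto
    then show ?thesis
      using odd_or_0 hub0 hub1 hub2 by (cases "Q 0"; cases "Q 1"; cases "Q 2"; auto)
  qed
  ultimately show ?thesis by simp
qed

lemma hub_coloring_inj:
  assumes "strong_odd_coloring (edge_graph 20 hub_edges) C \<phi>"
  shows "inj_on \<phi> {..<20}"
proof (rule inj_onI)
  fix x y :: nat
  assume xy: "x \<in> {..<20}" "y \<in> {..<20}" "\<phi> x = \<phi> y"
  define Q where "Q u \<longleftrightarrow> \<phi> u = \<phi> x" for u
  have proper: "\<forall>(u, v) \<in> set hub_edges. \<phi> u \<noteq> \<phi> v" and "\<phi> x \<in> C"
    and odd: "\<And>v. v < 20 \<Longrightarrow>
      card (neighbourhood (edge_graph 20 hub_edges) v \<inter> \<phi> -` {\<phi> x}) = 0 \<or>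
      odd (card (neighbourhood (edge_graph 20 hub_edges) v \<inter> \<phi> -` {\<phi> x}))"
    using assms xy(1)
    by (auto simp: strong_odd_coloring_def proper_coloring_def edge_graph_def image_subset_iff)
  have "distinct (adjacency hub_edges v)" for v
    by (rule distinct_adjacency[OF hub_edges_bounds]) (simp add: hub_edges_eq)
  then have "card (neighbourhood (edge_graph 20 hub_edges) v \<inter> \<phi> -` {\<phi> x}) =
      length (filter Q (adjacency hub_edges v))" for v
    using distinct_card[of "filter Q (adjacency hub_edges v)"]
    by (simp add: neighbourhood_edge_graph Q_def Int_def vimage_def)
  then have "length (filter Q [0..<20]) \<le> 1"
    using proper odd by (intro hub_color_class) (auto simp: Q_def)
  moreover have "length (filter Q [0..<20]) = card {u. u < 20 \<and> Q u}"
    using distinct_card[of "filter Q [0..<20]"] by simp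
  moreover have "card {x, y} \<le> card {u. u < 20 \<and> Q u}"
    using xy by (intro card_mono) (auto simp: Q_def)
  ultimately show "x = y" by (cases "x = y") auto
qed

theorem theorem2:
  shows "\<exists>G :: nat pair_pre_digraph.
    pair_graph G \<and> planar G \<and> strong_odd_chromatic_number G = 20"
proof (intro exI conjI)
  let ?G = "edge_graph 20 hub_edges"
  show graph: "pair_graph ?G"
    by (rule pair_graph_edge_graph) (rule hub_edges_bounds)
  show "planar ?G" by (rule planar_hub_graph)
  show "strong_odd_chromatic_number ?G = 20"
  proof (rule antisym)
    show "strong_odd_chromatic_number ?G \<le> 20"
      using strong_odd_coloring_card_pverts[OF graph]
      unfolding strong_odd_chromatic_number_def by (auto simp: edge_graph_def intro: Least_le)
    obtain \<phi> where \<phi>: "strong_odd_coloring ?G {..<strong_odd_chromatic_number ?G} \<phi>"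
      using strong_odd_coloring_chromatic_number[OF graph] by blast
    then have "\<phi> ` {..<20} \<subseteq> {..<strong_odd_chromatic_number ?G}"
      by (simp add: strong_odd_coloring_def proper_coloring_def edge_graph_def)
    then show "20 \<le> strong_odd_chromatic_number ?G"
      using card_inj_on_le[OF hub_coloring_inj[OF \<phi>]] by (metis card_lessThan finite_lessThan)
  qed
qed

end
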